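(* Let $0\le a\le1$, let $\Sigma\in\mathbb{R}^{m\times m}$ be the matrix with diagonal entries $1$ and all off-diagonal entries $a$, and let $\mathcal{U}=\{h\in\mathbb{R}^m_+:h^T\Sigma h\le1\}$. Put $$\beta=\left(\frac a2+\frac{(1-a)^{1/2}}{\big(am^2+(1-a)m\big)^{1/4}}\right)^{-1},\qquad \gamma=\frac1{\sqrt{am^2+(1-a)m}}.$$ Then $\hat{\mathcal{U}}=\beta\cdot\mathrm{conv}(e_1,\dots,e_m,\gamma e)$ dominates $\mathcal{U}$, one has $\beta=O(m^{2/5})$, and the piecewise affine solution described in the context (with these $\beta,\gamma$) gives an $O(m^{2/5})$-approximation to $\Pi_{AR}(\mathcal{U})$. Here the constants in $O(\cdot)$ are absolute (independent of $m$, $a$ and the data $(A,B,c,d)$).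
   Context: Vector inequalities are componentwise; $e_i$ is the $i$-th standard basis vector and $e$ the all-ones vector of $\mathbb{R}^m$; $(t)^+=\max(t,0)$; $\mathrm{conv}$ denotes convex hull. Two-stage adjustable robust problem $\Pi_{AR}(\mathcal{S})$: the data are $A\in\mathbb{R}_+^{m\times n}$, $B\in\mathbb{R}^{m\times n}$, $c,d\in\mathbb{R}^n_+$. For a set $\mathcal{S}\subseteq\mathbb{R}^m_+$, a feasible solution is a pair $(x,y(\cdot))$ with $x\in\mathbb{R}^n_+$, $y:\mathcal{S}\to\mathbb{R}^n_+$ and $Ax+By(h)\ge h$ for all $h\in\mathcal{S}$; the optimal value $z_{AR}(\mathcal{S})$ is the minimum (infimum) over feasible solutions of the worst-case cost $c^Tx+\max_{h\in\mathcal{S}}d^Ty(h)$ (max read as supremum; value $+\infty$ if infeasible). An optimal solution is a feasible solution whose worst-case cost equals $z_{AR}(\mathcal{S})<\infty$. A solution $(x,y(\cdot))$ gives an $\alpha$-approximation for $\Pi_{AR}(\mathcal{U})$ if it is feasible for $\Pi_{AR}(\mathcal{U})$ and $c^Tx+d^Ty(h)\le\alpha\cdot z_{AR}(\mathcal{U})$ for all $h\in\mathcal{U}$. Domination: $\hat{\mathcal{U}}\subseteq\mathbb{R}^m_+$ dominates $\mathcal{U}$ if for every $h\in\mathcal{U}$ there is $\hat h\in\hat{\mathcal{U}}$ with $\hat h\ge h$. Piecewise affine solution with parameters $\beta,\gamma$: let $(\hat x,\hat y(\cdot))$ be an optimal solution (assumed to exist) of $\Pi_{AR}$ over $\beta\cdot\mathrm{conv}(e_1,\dots,e_m,\gamma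 e)$. The piecewise affine solution is $x=2\hat x$, $y(h)=\frac1\beta\sum_{i=1}^m(h_i-\beta\gamma)^+\hat y(\beta e_i)+\hat y(\beta\gamma e)$ for $h\in\mathcal{U}$. *)

theory Defs
  imports "Jordan_Normal_Form.Matrix" "HOL-Library.Extended_Real"
begin

definition nonneg_vecs :: "nat \<Rightarrow> real vec set" where
  "nonneg_vecs k = {v \<in> carrier_vec k. 0\<^sub>v k \<le> v}"

definition ones_vec :: "nat \<Rightarrow> real vec" where
  "ones_vec m = vec m (\<lambda>i. 1)"

(* The type of vectors of all dimensions is not a real vector space, so the
   library predicate convex does not apply to it. *)
definition convex_vecs :: "nat \<Rightarrow> real vec set \<Rightarrow> bool" where
  "convex_vecs m C \<longleftrightarrow> C \<subseteq> carrier_vec m \<and>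
     (\<forall>x\<in>C. \<forall>y\<in>C. \<forall>u\<ge>0. \<forall>v\<ge>0. u + v = 1 \<longrightarrow> u \<cdot>\<^sub>v x + v \<cdot>\<^sub>v y \<in> C)"

definition conv_hull :: "nat \<Rightarrow> real vec set \<Rightarrow> real vec set" where
  "conv_hull m X = convex_vecs m hull X"

(* The second-stage decision y is a total function; only its values on S matter. *)
definition AR_feasible ::
  "nat \<Rightarrow> real mat \<Rightarrow> real mat \<Rightarrow> real vec set \<Rightarrow> real vec \<Rightarrow> (real vec \<Rightarrow> real vec) \<Rightarrow> bool" where
  "AR_feasible n A B S x y \<longleftrightarrow> x \<in> nonneg_vecs n \<and>
     (\<forall>h\<in>S. y h \<in> nonneg_vecs n \<and> h \<le> A *\<^sub>v x + B *\<^sub>v y h)"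

definition AR_cost ::
  "real vec \<Rightarrow> real vec \<Rightarrow> real vec set \<Rightarrow> real vec \<Rightarrow> (real vec \<Rightarrow> real vec) \<Rightarrow> ereal" where
  "AR_cost c d S x y = ereal (c \<bullet> x) + (SUP h\<in>S. ereal (d \<bullet> y h))"

definition z_AR ::
  "nat \<Rightarrow> real mat \<Rightarrow> real mat \<Rightarrow> real vec \<Rightarrow> real vec \<Rightarrow> real vec set \<Rightarrow> ereal" where
  "z_AR n A B c d S = (INF (x, y)\<in>{(x, y). AR_feasible n A B S x y}. AR_cost c d S x y)"

definition AR_optimal ::
  "nat \<Rightarrow> real mat \<Rightarrow> real mat \<Rightarrow> real vec \<Rightarrow> real vec \<Rightarrow> real vec set \<Rightarrow>
   real vec \<Rightarrow> (real vec \<Rightarrow> real vec) \<Rightarrow> bool" where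
  "AR_optimal n A B c d S x y \<longleftrightarrow> AR_feasible n A B S x y \<and>
     AR_cost c d S x y = z_AR n A B c d S \<and> z_AR n A B c d S < \<infinity>"

definition AR_approximation ::
  "nat \<Rightarrow> real mat \<Rightarrow> real mat \<Rightarrow> real vec \<Rightarrow> real vec \<Rightarrow> real vec set \<Rightarrow> real \<Rightarrow>
   real vec \<Rightarrow> (real vec \<Rightarrow> real vec) \<Rightarrow> bool" where
  "AR_approximation n A B c d U \<alpha> x y \<longleftrightarrow> AR_feasible n A B U x y \<and>
     (\<forall>h\<in>U. ereal (c \<bullet> x + d \<bullet> y h) \<le> ereal \<alpha> * z_AR n A B c d U)"

definition dominates :: "nat \<Rightarrow> real vec set \<Rightarrow> real vec set \<Rightarrow> bool" where
  "dominates m U' U \<longleftrightarrow> U' \<subseteq> nonneg_vecs m \<and> (\<forall>h\<in>U. \<exists>h'\<in>U'. h \<le> h')"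

definition dominating_set :: "nat \<Rightarrow> real \<Rightarrow> real \<Rightarrow> real vec set" where
  "dominating_set m \<beta> \<gamma> =
     (\<lambda>v. \<beta> \<cdot>\<^sub>v v) ` conv_hull m (insert (\<gamma> \<cdot>\<^sub>v ones_vec m) (unit_vec m ` {..<m}))"

definition pw_affine_x :: "real vec \<Rightarrow> real vec" where
  "pw_affine_x xhat = 2 \<cdot>\<^sub>v xhat"

definition pw_affine_y ::
  "nat \<Rightarrow> nat \<Rightarrow> real \<Rightarrow> real \<Rightarrow> (real vec \<Rightarrow> real vec) \<Rightarrow> real vec \<Rightarrow> real vec" where
  "pw_affine_y m n \<beta> \<gamma> yhat h =
     (1 / \<beta>) \<cdot>\<^sub>v finsum_vec TYPE(real) n
        (\<lambda>i. max (h $ i - \<beta> * \<gamma>) 0 \<cdot>\<^sub>v yhat (\<beta> \<cdot>\<^sub>v unit_vec m i)) {..<m}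
     + yhat ((\<beta> * \<gamma>) \<cdot>\<^sub>v ones_vec m)"

definition Sigma_mat :: "nat \<Rightarrow> real \<Rightarrow> real mat" where
  "Sigma_mat m a = mat m m (\<lambda>(i, j). if i = j then 1 else a)"

definition ellipsoid_set :: "nat \<Rightarrow> real \<Rightarrow> real vec set" where
  "ellipsoid_set m a = {h \<in> nonneg_vecs m. h \<bullet> (Sigma_mat m a *\<^sub>v h) \<le> 1}"

definition beta :: "nat \<Rightarrow> real \<Rightarrow> real" where
  "beta m a = inverse (a / 2 +
     sqrt (1 - a) / (a * real m ^ 2 + (1 - a) * real m) powr (1 / 4))"

definition gamma :: "nat \<Rightarrow> real \<Rightarrow> real" where
  "gamma m a = 1 / sqrt (a * real m ^ 2 + (1 - a) * real m)"

end

(* A vector h >= 0 is dominated by beta conv(e_1, ..., e_m, gamma e) iff some t in [0,1]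
   satisfies sum (h_i - t beta gamma)^+ <= beta (1 - t).  By duality such a t exists as soon as
   p = w . h <= beta for all weights 0 <= w <= 1 of total weight 1 / gamma.  On the ellipsoid,
   p <= sum h_i and, by Cauchy-Schwarz, gamma p^2 <= |h|^2, so that (a + (1 - a) gamma) p^2 <= 1;
   the choice of beta makes beta >= (a + (1 - a) gamma)^(-1/2).

   Conversely e_i and gamma e lie in the ellipsoid U, so the dominating set is contained in beta U
   and its optimal value is at most beta z_AR(U).  Since sum (h_i - beta gamma)^+ <= beta on U, the
   piecewise affine solution costs at most twice that value. *)

theory Submission
  imports Defs
begin

section \<open>Threshold weights, duality and weighted Cauchy-Schwarz\<close>

text \<open>Greedy solution of the fractional knapsack problem with capacity \<open>K\<close>:
  weight 1 strictly above a threshold \<open>\<theta>\<close>, weight 0 below it, and the rest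
  spread over the ties. The last property is complementary slackness, which makes \<open>w\<close>
  an optimal weighting for \<open>h\<close>.\<close>

lemma threshold_weights:
  fixes h :: "'i \<Rightarrow> real" and K :: real
  assumes fin: "finite I" and K: "0 < K" "K \<le> real (card I)"
  obtains \<theta> w where "\<theta> \<in> h ` I" "\<And>i. i \<in> I \<Longrightarrow> 0 \<le> w i \<and> w i \<le> 1" "sum w I = K"
    "\<And>i. i \<in> I \<Longrightarrow> w i * (h i - \<theta>) = max (h i - \<theta>) 0"
proof -
  have ne: "I \<noteq> {}" using K by auto
  \<comment> \<open>Values of \<open>h\<close> that are reached or exceeded by at least
    \<open>K\<close> indices; the threshold is the largest of them.\<close>
  define T where "T = {x \<in> h ` I. K \<le> real (card {i \<in> I. x \<le> h i})}"
  have finT: "finite T" using fin by (simp add: T_def)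
  have "{i \<in> I. Min (h ` I) \<le> h i} = I" using fin by auto
  then have "Min (h ` I) \<in> T" using fin ne K by (simp add: T_def)
  then have neT: "T \<noteq> {}" by auto
  define \<theta> where "\<theta> = Max T"
  have \<theta>T: "\<theta> \<in> T" using finT neT by (simp add: \<theta>_def)
  define G E where "G = {i \<in> I. \<theta> < h i}" and "E = {i \<in> I. h i = \<theta>}"
  have finGE: "finite G" "finite E" "G \<inter> E = {}" using fin by (auto simp: G_def E_def)
  have "G \<union> E = {i \<in> I. \<theta> \<le> h i}" by (auto simp: G_def E_def)
  then have KGE: "K \<le> real (card G) + real (card E)"
    using \<theta>T card_Un_disjoint[OF finGE] by (simp add: T_def)
  \<comment> \<open>If \<open>K\<close> or more indices lay strictly above \<open>\<theta>\<close>,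
    the smallest value among them would be an element of \<open>T\<close> larger than its
    maximum.\<close>
  have KG: "real (card G) < K"
  proof (cases "G = {}")
    case False
    define x where "x = Min (h ` G)"
    have "x \<in> h ` G" using False finGE by (simp add: x_def)
    then have x: "x \<in> h ` I" "\<theta> < x" by (auto simp: G_def)
    have "x \<le> h i" if "i \<in> G" for i using that finGE by (simp add: x_def)
    with x have "{i \<in> I. x \<le> h i} = G" by (force simp: G_def)
    moreover have "x \<notin> T" using x(2) Max_ge[OF finT, of x] unfolding \<theta>_def by linarith
    ultimately show ?thesis using x by (auto simp: T_def)
  qed (use K in simp)
  then have E0: "0 < real (card E)" using KGE by linarith
  \<comment> \<open>The ties share the remaining weight \<open>K - card G\<close> equally;
    \<open>KG\<close> and \<open>KGE\<close> put each share between 0 and 1.\<close>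
  define w where "w i = (if i \<in> G then 1 else if i \<in> E then (K - card G) / card E else 0)" for i
  show thesis
  proof
    show "\<theta> \<in> h ` I" using \<theta>T by (simp add: T_def)
    show "0 \<le> w i \<and> w i \<le> 1" if "i \<in> I" for i
      using KG KGE E0 by (auto simp: w_def divide_simps)
    show "w i * (h i - \<theta>) = max (h i - \<theta>) 0" if "i \<in> I" for i
      using that by (auto simp: w_def G_def E_def)
    have "sum w I = sum w (G \<union> E)"
      by (rule sum.mono_neutral_right) (use fin in \<open>auto simp: w_def G_def E_def\<close>)
    also have "\<dots> = sum w G + sum w E" by (rule sum.union_disjoint) (use finGE in auto)
    also have "sum w G = card G" by (simp add: w_def)
    also have "sum w E = (\<Sum>i\<in>E. (K - card G) / card E)"
      by (rule sum.cong) (use finGE in \<open>auto simp: w_def\<close>)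
    also have "\<dots> = K - card G" using E0 by simp
    finally show "sum w I = K" by simp
  qed
qed

text \<open>Linear programming duality: the largest weighted sum in the hypothesis is the
  support-function form of membership of \<open>h\<close> in the dominated region.\<close>

lemma level_exists:
  fixes h :: "'i \<Rightarrow> real"
  assumes fin: "finite I" and h: "\<And>i. i \<in> I \<Longrightarrow> 0 \<le> h i"
    and \<gamma>: "0 < \<gamma>" "1 / \<gamma> \<le> real (card I)" and \<beta>: "0 < \<beta>"
    and bound: "\<And>w. (\<And>i. i \<in> I \<Longrightarrow> 0 \<le> w i \<and> w i \<le> 1) \<Longrightarrow> sum w I = 1 / \<gamma> \<Longrightarrow>
                  (\<Sum>i\<in>I. w i * h i) \<le> \<beta>"
  shows "\<exists>t. 0 \<le> t \<and> t \<le> 1 \<and> (\<Sum>i\<in>I. max (h i - t * (\<beta> * \<gamma>)) 0) \<le> \<beta> * (1 - t)"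
proof -
  obtain \<theta> w where \<theta>: "\<theta> \<in> h ` I" and w: "\<And>i. i \<in> I \<Longrightarrow> 0 \<le> w i \<and> w i \<le> 1" "sum w I = 1 / \<gamma>"
    and max: "\<And>i. i \<in> I \<Longrightarrow> w i * (h i - \<theta>) = max (h i - \<theta>) 0"
    using threshold_weights[OF fin, of "1 / \<gamma>" h] \<gamma> by auto
  \<comment> \<open>Chosen so that the threshold of the excess is exactly
    \<open>\<theta>\<close>.\<close>
  define t where "t = \<theta> / (\<beta> * \<gamma>)"
  have t: "t * (\<beta> * \<gamma>) = \<theta>" "0 \<le> t" using \<beta> \<gamma> \<theta> h by (auto simp: t_def)
  have "(\<Sum>i\<in>I. max (h i - \<theta>) 0) = (\<Sum>i\<in>I. w i * (h i - \<theta>))"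
    using max by simp
  also have "\<dots> = (\<Sum>i\<in>I. w i * h i) - \<theta> * sum w I"
    by (simp add: right_diff_distrib sum_subtractf sum_distrib_left mult.commute)
  also have "\<theta> * sum w I = \<beta> * t" using w(2) \<gamma> \<beta> by (simp add: t_def)
  finally have le: "(\<Sum>i\<in>I. max (h i - \<theta>) 0) \<le> \<beta> * (1 - t)"
    using bound[OF w] by (simp add: algebra_simps)
  \<comment> \<open>The bound \<open>t \<le> 1\<close> comes for free: a sum of positive parts lies
    below \<open>\<beta> * (1 - t)\<close>.\<close>
  have "0 \<le> (\<Sum>i\<in>I. max (h i - \<theta>) 0)" by (intro sum_nonneg) auto
  then have "0 \<le> \<beta> * (1 - t)" using le by linarith
  then have "t \<le> 1" using \<beta> by (simp add: zero_le_mult_iff)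
  then show ?thesis using t le by auto
qed

text \<open>Cauchy-Schwarz for the weights \<open>w\<close>, followed by \<open>w i \<le> 1\<close>
  to drop the weights on the right.\<close>

lemma weighted_sum_square_le:
  fixes h w :: "'i \<Rightarrow> real"
  assumes w: "\<And>i. i \<in> I \<Longrightarrow> 0 \<le> w i \<and> w i \<le> 1" and pos: "0 < sum w I"
  shows "(\<Sum>i\<in>I. w i * h i)\<^sup>2 \<le> sum w I * (\<Sum>i\<in>I. (h i)\<^sup>2)"
proof -
  define W p where "W = sum w I" and "p = (\<Sum>i\<in>I. w i * h i)"
  \<comment> \<open>A weighted variance about the mean \<open>p / W\<close>, with denominators
    cleared; expanding it leaves the factor \<open>W\<close>, which is positive.\<close>
  have "0 \<le> (\<Sum>i\<in>I. w i * (W * h i - p)\<^sup>2)"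
    using w by (intro sum_nonneg) auto
  also have "\<dots> = (\<Sum>i\<in>I. W\<^sup>2 * (w i * (h i)\<^sup>2) - 2 * W * p * (w i * h i) + p\<^sup>2 * w i)"
    by (rule sum.cong) (auto simp: power2_eq_square algebra_simps)
  also have "\<dots> = W\<^sup>2 * (\<Sum>i\<in>I. w i * (h i)\<^sup>2) - 2 * W * p * p + p\<^sup>2 * W"
    unfolding sum.distrib sum_subtractf sum_distrib_left[symmetric] W_def p_def ..
  also have "\<dots> = W * (W * (\<Sum>i\<in>I. w i * (h i)\<^sup>2) - p\<^sup>2)"
    by (simp add: power2_eq_square algebra_simps)
  finally have "p\<^sup>2 \<le> W * (\<Sum>i\<in>I. w i * (h i)\<^sup>2)"
    using pos by (simp add: W_def zero_le_mult_iff)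
  also have "\<dots> \<le> W * (\<Sum>i\<in>I. (h i)\<^sup>2)"
    using w pos by (intro mult_left_mono sum_mono) (auto simp: W_def intro: mult_left_le_one_le)
  finally show ?thesis by (simp add: W_def p_def)
qed

section \<open>Estimates for \<open>gamma\<close> and \<open>beta\<close>, and the level for points
  of the ellipsoid\<close>

context
  fixes m :: nat and a :: real
  assumes m: "1 \<le> m" and a: "0 \<le> a" "a \<le> 1"
begin

text \<open>The value \<open>e\<^sup>T \<Sigma> e\<close> at the all-ones vector, which is also \<open>1 / \<gamma>\<^sup>2\<close>.\<close>

abbreviation (input) "ones_form \<equiv> a * real m ^ 2 + (1 - a) * real m"

lemma ones_form_bounds: "real m \<le> ones_form" "1 \<le> ones_form" "ones_form \<le> real m ^ 2"
proof -
  have r: "1 \<le> real m" using m by simp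
  then have sq: "real m \<le> real m ^ 2" by (simp add: power2_eq_square)
  have "a * real m \<le> a * real m ^ 2" using sq a by (intro mult_left_mono)
  then show "real m \<le> ones_form" by (simp add: algebra_simps)
  with r show "1 \<le> ones_form" by linarith
  have "(1 - a) * real m \<le> (1 - a) * real m ^ 2" using sq a by (intro mult_left_mono) auto
  then show "ones_form \<le> real m ^ 2" by (simp add: algebra_simps)
qed

lemma gamma_bounds: "0 < gamma m a" "gamma m a \<le> 1" "1 / gamma m a \<le> real m"
proof -
  show "0 < gamma m a" "gamma m a \<le> 1" using ones_form_bounds by (auto simp: gamma_def)
  have "sqrt ones_form \<le> real m" using ones_form_bounds(3) real_le_lsqrt by simp
  then show "1 / gamma m a \<le> real m" by (simp add: gamma_def)
qed

lemma gamma_square: "(gamma m a)\<^sup>2 * ones_form = 1"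
  using ones_form_bounds(2) by (simp add: gamma_def power_divide)

text \<open>The fourth root in the definition of \<open>beta\<close> is the square root of
  \<open>1 / gamma m a\<close>.\<close>

lemma beta_eq: "beta m a = inverse (a / 2 + sqrt ((1 - a) * gamma m a))"
proof -
  have "ones_form powr (1 / 4) = (ones_form powr (1 / 2)) powr (1 / 2)" by (simp add: powr_powr)
  also have "\<dots> = sqrt (sqrt ones_form)" using ones_form_bounds(2) by (simp add: powr_half_sqrt)
  finally show ?thesis
    by (simp add: beta_def gamma_def real_sqrt_mult real_sqrt_divide)
qed

lemma inverse_beta_pos: "0 < a / 2 + sqrt ((1 - a) * gamma m a)"
  using gamma_bounds(1) a by (cases "a = 0") (auto intro!: add_pos_nonneg)

lemma beta_pos: "0 < beta m a"
  using inverse_beta_pos by (simp add: beta_eq)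

text \<open>With \<open>u\<close> the square root term, the square of \<open>a / 2 + u\<close> is
  \<open>a * (a / 4 + u) + u\<^sup>2\<close>, so it suffices that \<open>a / 4 + u \<le> 1\<close>.
  This follows from \<open>u \<le> 1 - a / 2\<close>.\<close>

lemma inverse_beta_le: "1 / beta m a \<le> sqrt (a + (1 - a) * gamma m a)"
proof -
  define u where "u = sqrt ((1 - a) * gamma m a)"
  have u0: "0 \<le> u" and usq: "u\<^sup>2 = (1 - a) * gamma m a"
    using gamma_bounds a by (auto simp: u_def)
  have "u\<^sup>2 \<le> 1 - a" using usq gamma_bounds a by (simp add: mult_left_le)
  \<comment> \<open>The two sides differ by the square of \<open>a / 2\<close>.\<close>
  also have "\<dots> \<le> (1 - a / 2)\<^sup>2" by (simp add: power2_eq_square algebra_simps)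
  finally have sq: "u\<^sup>2 \<le> (1 - a / 2)\<^sup>2" .
  have "u \<le> 1 - a / 2" by (rule power2_le_imp_le[OF sq]) (use a in simp)
  then have "a * (a / 4 + u) \<le> a * 1" using a by (intro mult_left_mono) auto
  then have "(a / 2 + u)\<^sup>2 \<le> a + u\<^sup>2" by (simp add: power2_eq_square algebra_simps)
  then have "a / 2 + u \<le> sqrt (a + (1 - a) * gamma m a)"
    using usq by (intro real_le_rsqrt) simp
  then show ?thesis by (simp add: beta_eq u_def inverse_eq_divide)
qed

text \<open>One of the two summands of \<open>1 / beta m a\<close> is always at least
  \<open>1 / (4 * r)\<close>: the term \<open>a / 2\<close> when \<open>a\<close> is at least
  \<open>1 / (2 * r)\<close>, and the square root otherwise, since a small \<open>a\<close> keeps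
  \<open>ones_form\<close> of order at most \<open>r ^ 4\<close>.\<close>

lemma beta_le: "beta m a \<le> 4 * real m powr (2 / 5)"
proof -
  define r where "r = real m powr (2 / 5)"
  have r1: "1 \<le> r" using m by (simp add: r_def ge_one_powr_ge_zero)
  have sg: "0 \<le> sqrt ((1 - a) * gamma m a)" using gamma_bounds a by simp
  have "1 / (4 * r) \<le> a / 2 + sqrt ((1 - a) * gamma m a)"
  proof (cases "1 / (2 * r) \<le> a")
    case True
    then have "1 / (4 * r) \<le> a / 2" by (simp add: field_simps)
    then show ?thesis using sg by linarith
  next
    case False
    \<comment> \<open>The identity that fixes the exponent 2/5: at \<open>a\<close> of order
      \<open>1 / r\<close>, the term \<open>a * real m ^ 2\<close> has order \<open>r ^ 4\<close>,
      so the fourth root is of order \<open>r\<close> and both summands balance.\<close>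
    have r5: "r ^ 4 * r = real m ^ 2"
    proof -
      have "r ^ 5 = real m powr 2" using m by (simp add: r_def powr_power)
      then show ?thesis using m by (simp add: powr_numeral eval_nat_numeral mult.commute mult.left_commute)
    qed
    have mr: "real m \<le> r ^ 4"
    proof -
      have "real m powr 1 \<le> real m powr (8 / 5)" using m by (intro powr_mono) auto
      then show ?thesis using m by (simp add: r_def powr_power)
    qed
    have ar: "a * r \<le> 1 / 2" using False r1 by (simp add: field_simps)
    have "a * 1 \<le> a * r" using a r1 by (intro mult_left_mono)
    then have a2: "a \<le> 1 / 2" using ar by linarith
    have "a * real m ^ 2 = (a * r) * r ^ 4" using r5 by (simp add: mult_ac)
    also have "\<dots> \<le> 1 / 2 * r ^ 4" using ar r1 by (intro mult_right_mono) auto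
    finally have "ones_form \<le> 1 / 2 * r ^ 4 + 1 * r ^ 4"
    proof (intro add_mono)
      show "(1 - a) * real m \<le> 1 * r ^ 4" using mr a by (intro mult_mono) auto
    qed
    also have "\<dots> \<le> (2 * r ^ 2)\<^sup>2" using r1 by (simp add: power_mult_distrib power_mult[symmetric])
    finally have "sqrt ones_form \<le> 2 * r ^ 2" by (intro real_le_lsqrt) auto
    moreover have "0 < sqrt ones_form" using ones_form_bounds by simp
    ultimately have "1 / (2 * r ^ 2) \<le> gamma m a" 
      unfolding gamma_def by (intro divide_left_mono) (use r1 in auto)
    then have "1 / 2 * (1 / (2 * r ^ 2)) \<le> (1 - a) * gamma m a"
      using a2 by (intro mult_mono) auto
    then have "(1 / (4 * r))\<^sup>2 \<le> (1 - a) * gamma m a"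
      using r1 by (simp add: power2_eq_square field_simps) 
    then have "1 / (4 * r) \<le> sqrt ((1 - a) * gamma m a)" by (rule real_le_rsqrt)
    then show ?thesis using a by linarith
  qed
  then have "inverse (a / 2 + sqrt ((1 - a) * gamma m a)) \<le> inverse (1 / (4 * r))"
    using r1 by (intro le_imp_inverse_le) auto
  then show ?thesis by (simp add: beta_eq r_def)
qed

text \<open>Supplies the hypothesis \<open>bound\<close> of \<open>level_exists\<close>. The two
  parts of the quadratic form are bounded below separately by multiples of \<open>p\<^sup>2\<close>,
  and \<open>inverse_beta_le\<close> compares the resulting constant with
  \<open>beta\<close>.\<close>

lemma weighted_sum_le_beta:
  fixes h w :: "nat \<Rightarrow> real"
  assumes h: "\<And>i. i < m \<Longrightarrow> 0 \<le> h i"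
    and q: "(1 - a) * (\<Sum>i<m. (h i)\<^sup>2) + a * (\<Sum>i<m. h i)\<^sup>2 \<le> 1"
    and w: "\<And>i. i < m \<Longrightarrow> 0 \<le> w i \<and> w i \<le> 1" and sw: "sum w {..<m} = 1 / gamma m a"
  shows "(\<Sum>i<m. w i * h i) \<le> beta m a"
proof -
  define p where "p = (\<Sum>i<m. w i * h i)"
  have p0: "0 \<le> p" unfolding p_def using h w by (intro sum_nonneg) auto
  have "p \<le> (\<Sum>i<m. h i)" unfolding p_def using h w
    by (intro sum_mono) (auto intro: mult_left_le_one_le)
  then have 1: "a * p\<^sup>2 \<le> a * (\<Sum>i<m. h i)\<^sup>2" using p0 a by (intro mult_left_mono power_mono) auto
  have "p\<^sup>2 \<le> 1 / gamma m a * (\<Sum>i<m. (h i)\<^sup>2)"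
    using weighted_sum_square_le[of "{..<m}" w h] w sw gamma_bounds(1) by (simp add: p_def)
  then have "gamma m a * p\<^sup>2 \<le> (\<Sum>i<m. (h i)\<^sup>2)"
    using gamma_bounds(1) by (simp add: field_simps)
  then have "(1 - a) * (gamma m a * p\<^sup>2) \<le> (1 - a) * (\<Sum>i<m. (h i)\<^sup>2)"
    using a by (intro mult_left_mono) auto
  with 1 q have "(a + (1 - a) * gamma m a) * p\<^sup>2 \<le> 1" by (simp add: algebra_simps)
  then have "sqrt ((a + (1 - a) * gamma m a) * p\<^sup>2) \<le> 1" by simp
  then have "sqrt (a + (1 - a) * gamma m a) * p \<le> 1" using p0 by (simp add: real_sqrt_mult)
  moreover have "1 / beta m a * p \<le> sqrt (a + (1 - a) * gamma m a) * p"
    using inverse_beta_le p0 by (intro mult_right_mono)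
  ultimately have "1 / beta m a * p \<le> 1" by linarith
  then show ?thesis using beta_pos by (simp add: p_def field_simps)
qed

lemma ellipsoid_level:
  fixes h :: "nat \<Rightarrow> real"
  assumes h: "\<And>i. i < m \<Longrightarrow> 0 \<le> h i"
    and q: "(1 - a) * (\<Sum>i<m. (h i)\<^sup>2) + a * (\<Sum>i<m. h i)\<^sup>2 \<le> 1"
  shows "\<exists>t. 0 \<le> t \<and> t \<le> 1 \<and>
    (\<Sum>i<m. max (h i - t * (beta m a * gamma m a)) 0) \<le> beta m a * (1 - t)"
proof (rule level_exists)
  show "(\<Sum>i<m. w i * h i) \<le> beta m a"
    if "\<And>i. i \<in> {..<m} \<Longrightarrow> 0 \<le> w i \<and> w i \<le> 1" "sum w {..<m} = 1 / gamma m a" for w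
    by (rule weighted_sum_le_beta[OF h q _ that(2)]) (use that(1) in auto)
qed (use h gamma_bounds beta_pos in auto)

end

section \<open>The ellipsoid: coordinate form, convexity, and the generators it contains\<close>

lemma nonneg_vecs_iff: "v \<in> nonneg_vecs k \<longleftrightarrow> dim_vec v = k \<and> (\<forall>i<k. 0 \<le> v $ i)"
  unfolding nonneg_vecs_def less_eq_vec_def carrier_vec_def by auto

text \<open>The matrix is \<open>1 - a\<close> times the identity plus \<open>a\<close> times the
  all-ones matrix; each diagonal entry 1 is split as \<open>(1 - a) + a\<close>.\<close>

lemma Sigma_quadratic_form:
  assumes "dim_vec h = m"
  shows "h \<bullet> (Sigma_mat m a *\<^sub>v h) = (1 - a) * (\<Sum>i<m. (h $ i)\<^sup>2) + a * (\<Sum>i<m. h $ i)\<^sup>2"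
proof -
  have row: "(\<Sum>j<m. (if i = j then 1 else a) * h $ j) = (1 - a) * h $ i + a * (\<Sum>j<m. h $ j)"
    if "i < m" for i
  proof -
    have "(\<Sum>j<m. (if i = j then 1 else a) * h $ j) =
      (\<Sum>j<m. (if i = j then (1 - a) * h $ i else 0) + a * h $ j)"
      by (rule sum.cong) (auto simp: algebra_simps)
    then show ?thesis using that by (simp add: sum.distrib sum_distrib_left)
  qed
  define S where "S = (\<Sum>i<m. h $ i)"
  have "h \<bullet> (Sigma_mat m a *\<^sub>v h) = (\<Sum>i<m. h $ i * (\<Sum>j<m. (if i = j then 1 else a) * h $ j))"
    using assms by (simp add: scalar_prod_def Sigma_mat_def lessThan_atLeast0)
  also have "\<dots> = (\<Sum>i<m. h $ i * ((1 - a) * h $ i + a * S))"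
    by (rule sum.cong) (use row in \<open>auto simp: S_def\<close>)
  also have "\<dots> = (\<Sum>i<m. (1 - a) * (h $ i)\<^sup>2 + a * S * h $ i)"
    by (rule sum.cong) (auto simp: algebra_simps power2_eq_square)
  also have "\<dots> = (1 - a) * (\<Sum>i<m. (h $ i)\<^sup>2) + a * S * S"
    unfolding sum.distrib sum_distrib_left[symmetric] S_def[symmetric] ..
  finally show ?thesis by (simp add: power2_eq_square S_def mult.assoc)
qed

lemma ellipsoid_set_iff:
  "h \<in> ellipsoid_set m a \<longleftrightarrow> dim_vec h = m \<and> (\<forall>i<m. 0 \<le> h $ i) \<and>
     (1 - a) * (\<Sum>i<m. (h $ i)\<^sup>2) + a * (\<Sum>i<m. h $ i)\<^sup>2 \<le> 1"
  by (auto simp: ellipsoid_set_def nonneg_vecs_iff Sigma_quadratic_form)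

lemma square_convex:
  fixes u v x y :: real
  assumes "0 \<le> u" "0 \<le> v" "u + v = 1"
  shows "(u * x + v * y)\<^sup>2 \<le> u * x\<^sup>2 + v * y\<^sup>2"
proof -
  have v: "v = 1 - u" using assms by simp
  have "u * x\<^sup>2 + v * y\<^sup>2 - (u * x + v * y)\<^sup>2 = u * v * (x - y)\<^sup>2"
    unfolding v by (simp add: power2_eq_square algebra_simps)
  moreover have "0 \<le> u * v * (x - y)\<^sup>2" using assms by simp
  ultimately show ?thesis by linarith
qed

text \<open>Both coefficients \<open>1 - a\<close> and \<open>a\<close> are nonnegative, so the form
  is a sum of convex squares of linear functions. Convexity is what lets the hull of the generators
  be placed inside the ellipsoid by \<open>hull_minimal\<close>.\<close>

lemma convex_ellipsoid_set:
  assumes a: "0 \<le> a" "a \<le> 1"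
  shows "convex_vecs m (ellipsoid_set m a)"
proof -
  have "u \<cdot>\<^sub>v x + v \<cdot>\<^sub>v y \<in> ellipsoid_set m a"
    if x: "x \<in> ellipsoid_set m a" and y: "y \<in> ellipsoid_set m a"
      and uv: "0 \<le> u" "0 \<le> v" "u + v = 1" for x y u v
  proof -
    let ?q = "\<lambda>h. (1 - a) * (\<Sum>i<m. (h $ i)\<^sup>2) + a * (\<Sum>i<m. h $ i)\<^sup>2"
    let ?z = "u \<cdot>\<^sub>v x + v \<cdot>\<^sub>v y"
    have z: "?z $ i = u * x $ i + v * y $ i" if "i < m" for i
      using that x y by (simp add: ellipsoid_set_iff)
    have "(\<Sum>i<m. (?z $ i)\<^sup>2) \<le> (\<Sum>i<m. u * (x $ i)\<^sup>2 + v * (y $ i)\<^sup>2)"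
      using uv z by (intro sum_mono) (simp add: square_convex)
    then have 1: "(1 - a) * (\<Sum>i<m. (?z $ i)\<^sup>2) \<le>
        (1 - a) * (u * (\<Sum>i<m. (x $ i)\<^sup>2) + v * (\<Sum>i<m. (y $ i)\<^sup>2))"
      using a by (intro mult_left_mono) (simp_all add: sum.distrib sum_distrib_left)
    have "(\<Sum>i<m. ?z $ i) = u * (\<Sum>i<m. x $ i) + v * (\<Sum>i<m. y $ i)"
      using z by (simp add: sum.distrib sum_distrib_left)
    then have 2: "a * (\<Sum>i<m. ?z $ i)\<^sup>2 \<le> a * (u * (\<Sum>i<m. x $ i)\<^sup>2 + v * (\<Sum>i<m. y $ i)\<^sup>2)"
      using a uv by (intro mult_left_mono) (simp_all add: square_convex)
    from 1 2 have "?q ?z \<le> u * ?q x + v * ?q y" by (simp add: algebra_simps)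
    also have "\<dots> \<le> u * 1 + v * 1"
      using x y uv by (intro add_mono mult_left_mono) (auto simp: ellipsoid_set_iff)
    finally have "?q ?z \<le> 1" using uv by simp
    then show ?thesis using x y uv by (auto simp: ellipsoid_set_iff)
  qed
  moreover have "ellipsoid_set m a \<subseteq> carrier_vec m" by (auto simp: ellipsoid_set_iff)
  ultimately show ?thesis unfolding convex_vecs_def by blast
qed

lemma unit_vec_in_ellipsoid:
  assumes "i < m" shows "unit_vec m i \<in> ellipsoid_set m a"
proof -
  have "(\<Sum>k<m. unit_vec m i $ k) = (1::real)" "(\<Sum>k<m. (unit_vec m i $ k)\<^sup>2) = (1::real)"
    using assms by (simp_all add: unit_vec_def if_distrib[of "\<lambda>x. x\<^sup>2"] cong: if_cong)
  then show ?thesis by (simp add: ellipsoid_set_iff unit_vec_def)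
qed

text \<open>The point lies on the boundary: \<open>gamma\<close> normalises the all-ones vector to
  quadratic form exactly 1.\<close>

lemma gamma_ones_in_ellipsoid:
  assumes "1 \<le> m" "0 \<le> a" "a \<le> 1"
  shows "gamma m a \<cdot>\<^sub>v ones_vec m \<in> ellipsoid_set m a"
proof -
  have "(1 - a) * (real m * (gamma m a)\<^sup>2) + a * (real m * gamma m a)\<^sup>2 = 1"
    using gamma_square[OF assms] by (simp add: algebra_simps power2_eq_square)
  then show ?thesis using gamma_bounds[OF assms] by (simp add: ellipsoid_set_iff ones_vec_def)
qed

lemma conv_hull_subset_ellipsoid:
  assumes "1 \<le> m" "0 \<le> a" "a \<le> 1"
  shows "conv_hull m (insert (gamma m a \<cdot>\<^sub>v ones_vec m) (unit_vec m ` {..<m})) \<subseteq> ellipsoid_set m a"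
  unfolding conv_hull_def
  by (rule hull_minimal)
    (use assms in \<open>auto simp: gamma_ones_in_ellipsoid unit_vec_in_ellipsoid convex_ellipsoid_set\<close>)

section \<open>Convex combinations and domination of the ellipsoid\<close>

text \<open>\<open>convex_vecs\<close> speaks of two points only. Induction splits off one point and
  rescales the remaining weights by their total \<open>r\<close>, hence the generalisation over
  \<open>u\<close>.\<close>

lemma convex_vecs_sum:
  assumes "convex_vecs m C" "finite I" "\<And>i. i \<in> I \<Longrightarrow> 0 \<le> u i" "sum u I = 1"
    "\<And>i. i \<in> I \<Longrightarrow> p i \<in> C"
  shows "vec m (\<lambda>k. \<Sum>i\<in>I. u i * p i $ k) \<in> C"
  using assms(2-)
proof (induction I arbitrary: u rule: finite_induct)
  case (insert j I)
  have pj: "p j \<in> C" "dim_vec (p j) = m"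
    using insert.prems(3)[of j] assms(1) by (auto simp: convex_vecs_def)
  define r where "r = sum u I"
  have r: "0 \<le> r" "u j + r = 1" "0 \<le> u j"
    using insert.prems insert.hyps by (auto simp: r_def intro: sum_nonneg)
  show ?case
  \<comment> \<open>Rescaling would divide by zero here; instead all remaining weights vanish and
    the combination is \<open>p j\<close> itself.\<close>
  proof (cases "r = 0")
    case True
    then have "u i = 0" if "i \<in> I" for i
      using that insert.prems(1) insert.hyps(1) sum_nonneg_eq_0_iff[of I u] by (auto simp: r_def)
    then have "vec m (\<lambda>k. \<Sum>i\<in>insert j I. u i * p i $ k) = p j"
      using True r insert.hyps pj by (intro eq_vecI) auto
    then show ?thesis using pj by simp
  next
    case False
    let ?v = "vec m (\<lambda>k. \<Sum>i\<in>I. u i / r * p i $ k)"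
    have "?v \<in> C"
    proof (rule insert.IH)
      show "(\<Sum>i\<in>I. u i / r) = 1" using False by (simp add: sum_divide_distrib[symmetric] r_def)
    qed (use insert.prems r in auto)
    then have "u j \<cdot>\<^sub>v p j + r \<cdot>\<^sub>v ?v \<in> C"
      using assms(1) pj r unfolding convex_vecs_def by blast
    also have "u j \<cdot>\<^sub>v p j + r \<cdot>\<^sub>v ?v = vec m (\<lambda>k. \<Sum>i\<in>insert j I. u i * p i $ k)"
      using False pj insert.hyps by (intro eq_vecI) (auto simp: sum_distrib_left)
    finally show ?thesis .
  qed
qed simp

lemma combination_in_dominating_set:
  assumes "\<And>i. i < m \<Longrightarrow> 0 \<le> l i" "0 \<le> t" "(\<Sum>i<m. l i) + t = 1"
  shows "vec m (\<lambda>k. \<beta> * (l k + t * \<gamma>)) \<in> dominating_set m \<beta> \<gamma>"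
proof -
  let ?X = "insert (\<gamma> \<cdot>\<^sub>v ones_vec m) (unit_vec m ` {..<m}) :: real vec set"
  \<comment> \<open>Index \<open>m\<close> carries the generator
    \<open>\<gamma> \<cdot>\<^sub>v ones_vec m\<close>, so that all generators form one family over
    \<open>{..<Suc m}\<close>.\<close>
  let ?u = "\<lambda>i. if i < m then l i else t"
  let ?p = "\<lambda>i. if i < m then unit_vec m i else \<gamma> \<cdot>\<^sub>v ones_vec m :: real vec"
  have eq: "(\<Sum>i<Suc m. ?u i * ?p i $ k) = l k + t * \<gamma>" if "k < m" for k
  proof -
    have "(\<Sum>i<m. ?u i * ?p i $ k) = (\<Sum>i<m. if i = k then l k else 0)"
      using that by (intro sum.cong) (auto simp: unit_vec_def)
    then show ?thesis using that by (simp add: ones_vec_def)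
  qed
  have "vec m (\<lambda>k. l k + t * \<gamma>) \<in> C" if C: "?X \<subseteq> C" "convex_vecs m C" for C
  proof -
    have "vec m (\<lambda>k. \<Sum>i<Suc m. ?u i * ?p i $ k) \<in> C"
      by (rule convex_vecs_sum[OF C(2)]) (use assms C(1) in auto)
    also have "vec m (\<lambda>k. \<Sum>i<Suc m. ?u i * ?p i $ k) = vec m (\<lambda>k. l k + t * \<gamma>)"
      using eq by (intro eq_vecI) auto
    finally show ?thesis .
  qed
  then have "vec m (\<lambda>k. l k + t * \<gamma>) \<in> conv_hull m ?X"
    unfolding conv_hull_def hull_def by blast
  then have "\<beta> \<cdot>\<^sub>v vec m (\<lambda>k. l k + t * \<gamma>) \<in> dominating_set m \<beta> \<gamma>"
    unfolding dominating_set_def by blast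
  also have "\<beta> \<cdot>\<^sub>v vec m (\<lambda>k. l k + t * \<gamma>) = vec m (\<lambda>k. \<beta> * (l k + t * \<gamma>))"
    by (intro eq_vecI) auto
  finally show ?thesis .
qed

lemma unit_vec_in_dominating_set:
  assumes "i < m" shows "\<beta> \<cdot>\<^sub>v unit_vec m i \<in> dominating_set m \<beta> \<gamma>"
  using assms unfolding dominating_set_def conv_hull_def by (intro imageI hull_inc) auto

lemma ones_vec_in_dominating_set: "(\<beta> * \<gamma>) \<cdot>\<^sub>v ones_vec m \<in> dominating_set m \<beta> \<gamma>"
proof -
  have "\<beta> \<cdot>\<^sub>v (\<gamma> \<cdot>\<^sub>v ones_vec m) \<in> dominating_set m \<beta> \<gamma>"
    unfolding dominating_set_def conv_hull_def by (intro imageI hull_inc) auto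
  then show ?thesis by (simp add: smult_smult_assoc)
qed

lemma dominating_set_subset:
  assumes "1 \<le> m" "0 \<le> a" "a \<le> 1"
  shows "dominating_set m (beta m a) (gamma m a) \<subseteq> (\<lambda>g. beta m a \<cdot>\<^sub>v g) ` ellipsoid_set m a"
  unfolding dominating_set_def using conv_hull_subset_ellipsoid[OF assms] by blast

lemma ellipsoid_set_level:
  assumes "1 \<le> m" "0 \<le> a" "a \<le> 1" "h \<in> ellipsoid_set m a"
  obtains t where "0 \<le> t" "t \<le> 1"
    "(\<Sum>i<m. max (h $ i - t * (beta m a * gamma m a)) 0) \<le> beta m a * (1 - t)"
proof -
  have "\<exists>t. 0 \<le> t \<and> t \<le> 1 \<and>
      (\<Sum>i<m. max (h $ i - t * (beta m a * gamma m a)) 0) \<le> beta m a * (1 - t)"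
    by (rule ellipsoid_level) (use assms in \<open>simp_all add: ellipsoid_set_iff\<close>)
  then show thesis using that by blast
qed

text \<open>The level \<open>t\<close> becomes the coefficient of \<open>gamma\<close> times the
  all-ones vector, and the excess of \<open>h\<close> over \<open>t * beta * gamma\<close>, divided
  by \<open>beta\<close>, gives the coefficients of the unit vectors.\<close>

lemma dominates_ellipsoid:
  assumes ma: "1 \<le> m" "0 \<le> a" "a \<le> 1"
  shows "dominates m (dominating_set m (beta m a) (gamma m a)) (ellipsoid_set m a)"
  unfolding dominates_def
proof (intro conjI ballI)
  show "dominating_set m (beta m a) (gamma m a) \<subseteq> nonneg_vecs m"
  proof
    fix v assume "v \<in> dominating_set m (beta m a) (gamma m a)"
    then obtain g where "v = beta m a \<cdot>\<^sub>v g" "g \<in> ellipsoid_set m a"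
      using dominating_set_subset[OF ma] by blast
    then show "v \<in> nonneg_vecs m"
      using beta_pos[OF ma] by (simp add: ellipsoid_set_iff nonneg_vecs_iff)
  qed
next
  fix h assume h: "h \<in> ellipsoid_set m a"
  define b g where "b = beta m a" and "g = gamma m a"
  have b: "0 < b" using beta_pos[OF ma] by (simp add: b_def)
  obtain t where t: "0 \<le> t" "t \<le> 1"
    and le: "(\<Sum>i<m. max (h $ i - t * (b * g)) 0) \<le> b * (1 - t)"
    unfolding b_def g_def by (rule ellipsoid_set_level[OF ma h])
  define s where "s = (\<Sum>i<m. max (h $ i - t * (b * g)) 0 / b)"
  have s: "s \<le> 1 - t" using le b by (simp add: s_def sum_divide_distrib[symmetric] field_simps)
  define l where "l i = max (h $ i - t * (b * g)) 0 / b + (if i = 0 then 1 - t - s else 0)" for i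
  have "sum l {..<m} = 1 - t"
    unfolding l_def using ma by (simp add: sum.distrib s_def)
  moreover have "0 \<le> l i" for i using b s by (auto simp: l_def)
  ultimately have "vec m (\<lambda>k. b * (l k + t * g)) \<in> dominating_set m b g"
    using t by (intro combination_in_dominating_set) auto
  moreover have "h \<le> vec m (\<lambda>k. b * (l k + t * g))"
  proof -
    have "h $ i \<le> b * (l i + t * g)" for i
    proof -
      have "h $ i \<le> b * (max (h $ i - t * (b * g)) 0 / b + t * g)"
        using b by (simp add: algebra_simps)
      also have "\<dots> \<le> b * (l i + t * g)"
        using b s by (intro mult_left_mono) (auto simp: l_def)
      finally show ?thesis .
    qed
    then show ?thesis using h by (auto simp: less_eq_vec_def ellipsoid_set_iff)
  qed
  ultimately show "\<exists>h'\<in>dominating_set m (beta m a) (gamma m a). h \<le> h'"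
    by (auto simp: b_def g_def)
qed

text \<open>Raising the threshold from \<open>t * beta * gamma\<close> to
  \<open>beta * gamma\<close> only shrinks the excess. The lemma says that the weights of the
  piecewise affine solution have total at most 1.\<close>

lemma sum_excess_le_beta:
  assumes ma: "1 \<le> m" "0 \<le> a" "a \<le> 1" and h: "h \<in> ellipsoid_set m a"
  shows "(\<Sum>i<m. max (h $ i - beta m a * gamma m a) 0) \<le> beta m a"
proof -
  let ?b = "beta m a" and ?g = "gamma m a"
  note bg = beta_pos[OF ma] gamma_bounds(1)[OF ma]
  obtain t where t: "0 \<le> t" "t \<le> 1"
    and le: "(\<Sum>i<m. max (h $ i - t * (?b * ?g)) 0) \<le> ?b * (1 - t)"
    by (rule ellipsoid_set_level[OF ma h])
  have "t * (?b * ?g) \<le> ?b * ?g" using t bg by (intro mult_left_le_one_le) auto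
  then have "(\<Sum>i<m. max (h $ i - ?b * ?g) 0) \<le> (\<Sum>i<m. max (h $ i - t * (?b * ?g)) 0)"
    by (intro sum_mono) auto
  also have "\<dots> \<le> ?b * (1 - t)" by (rule le)
  also have "\<dots> \<le> ?b" using t bg by (simp add: mult_left_le)
  finally show ?thesis .
qed

section \<open>The adjustable problem: scaling, feasibility and cost of the piecewise affine
  solution\<close>

lemma scalar_prod_nonneg_vecs:
  assumes "u \<in> nonneg_vecs n" "v \<in> nonneg_vecs n"
  shows "0 \<le> u \<bullet> v"
  using assms unfolding scalar_prod_def by (intro sum_nonneg) (simp add: nonneg_vecs_iff)

lemma nonneg_vecs_carrier: "v \<in> nonneg_vecs n \<Longrightarrow> v \<in> carrier_vec n"
  by (simp add: nonneg_vecs_def)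

lemma AR_feasible_iff:
  assumes "A \<in> carrier_mat m n" "B \<in> carrier_mat m n" "S \<subseteq> carrier_vec m"
  shows "AR_feasible n A B S x y \<longleftrightarrow> x \<in> nonneg_vecs n \<and>
    (\<forall>h\<in>S. y h \<in> nonneg_vecs n \<and> (\<forall>j<m. h $ j \<le> row A j \<bullet> x + row B j \<bullet> y h))"
  using assms unfolding AR_feasible_def less_eq_vec_def by (auto simp: subset_eq)

text \<open>The witness \<open>g\<close> matters: over an empty set the supremum in
  \<open>ereal\<close> would be minus infinity.\<close>

lemma SUP_second_stage_nonneg:
  assumes "d \<in> nonneg_vecs n" "g \<in> S" "y g \<in> nonneg_vecs n"
  shows "0 \<le> (SUP h\<in>S. ereal (d \<bullet> y h))"
proof -
  have "0 \<le> ereal (d \<bullet> y g)" using assms by (simp add: scalar_prod_nonneg_vecs)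
  also have "\<dots> \<le> (SUP h\<in>S. ereal (d \<bullet> y h))" using assms by (intro SUP_upper)
  finally show ?thesis .
qed

text \<open>Constraints and cost are homogeneous of degree one, so scaling \<open>x\<close> and
  \<open>y\<close> by \<open>\<beta>\<close> turns a solution over \<open>S\<close> into one over
  the scaled set, and hence over its subset \<open>S'\<close>.\<close>

lemma z_AR_le_scaled_cost:
  assumes AB: "A \<in> carrier_mat m n" "B \<in> carrier_mat m n"
    and cd: "c \<in> nonneg_vecs n" "d \<in> nonneg_vecs n"
    and \<beta>: "0 < \<beta>" and S: "S \<subseteq> carrier_vec m" and S': "S' \<subseteq> (\<lambda>g. \<beta> \<cdot>\<^sub>v g) ` S"
    and feas: "AR_feasible n A B S x y"
  shows "z_AR n A B c d S' \<le> ereal \<beta> * AR_cost c d S x y"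
proof -
  define y' where "y' h = \<beta> \<cdot>\<^sub>v y ((1 / \<beta>) \<cdot>\<^sub>v h)" for h
  have y': "y' (\<beta> \<cdot>\<^sub>v g) = \<beta> \<cdot>\<^sub>v y g" for g
    using \<beta> by (simp add: y'_def smult_smult_assoc)
  have S'c: "S' \<subseteq> carrier_vec m" using S S' by fastforce
  have x: "x \<in> nonneg_vecs n"
    and y: "\<And>g. g \<in> S \<Longrightarrow> y g \<in> nonneg_vecs n"
    and le: "\<And>g j. g \<in> S \<Longrightarrow> j < m \<Longrightarrow> g $ j \<le> row A j \<bullet> x + row B j \<bullet> y g"
    using feas AR_feasible_iff[OF AB S] by auto
  have scale: "\<beta> \<cdot>\<^sub>v v \<in> nonneg_vecs n" if "v \<in> nonneg_vecs n" for v
    using that \<beta> by (simp add: nonneg_vecs_iff)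
  have "AR_feasible n A B S' (\<beta> \<cdot>\<^sub>v x) y'"
    unfolding AR_feasible_iff[OF AB S'c]
  proof (intro conjI ballI allI impI)
    show "\<beta> \<cdot>\<^sub>v x \<in> nonneg_vecs n" by (rule scale[OF x])
    fix h assume "h \<in> S'"
    then obtain g where g: "h = \<beta> \<cdot>\<^sub>v g" "g \<in> S" using S' by auto
    then show "y' h \<in> nonneg_vecs n" using y' scale y by simp
    fix j assume j: "j < m"
    have "\<beta> * g $ j \<le> \<beta> * (row A j \<bullet> x + row B j \<bullet> y g)"
      using le[OF g(2) j] \<beta> by (intro mult_left_mono) auto
    moreover have "dim_vec g = m" using g(2) S by auto
    moreover have "row A j \<bullet> (\<beta> \<cdot>\<^sub>v x) = \<beta> * (row A j \<bullet> x)"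
      using AB j nonneg_vecs_carrier[OF x] by (intro scalar_prod_smult_distrib) auto
    moreover have "row B j \<bullet> (\<beta> \<cdot>\<^sub>v y g) = \<beta> * (row B j \<bullet> y g)"
      using AB j nonneg_vecs_carrier[OF y[OF g(2)]] by (intro scalar_prod_smult_distrib) auto
    ultimately show "h $ j \<le> row A j \<bullet> (\<beta> \<cdot>\<^sub>v x) + row B j \<bullet> y' h"
      using j by (simp add: g(1) y' algebra_simps)
  qed
  then have "z_AR n A B c d S' \<le> AR_cost c d S' (\<beta> \<cdot>\<^sub>v x) y'"
    unfolding z_AR_def by (intro INF_lower2[of "(\<beta> \<cdot>\<^sub>v x, y')"]) auto
  also have "\<dots> \<le> ereal \<beta> * ereal (c \<bullet> x) + ereal \<beta> * (SUP h\<in>S. ereal (d \<bullet> y h))"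
    unfolding AR_cost_def
  proof (intro add_mono SUP_least)
    have "c \<bullet> (\<beta> \<cdot>\<^sub>v x) = \<beta> * (c \<bullet> x)"
      using cd x by (intro scalar_prod_smult_distrib) (auto dest: nonneg_vecs_carrier)
    then show "ereal (c \<bullet> (\<beta> \<cdot>\<^sub>v x)) \<le> ereal \<beta> * ereal (c \<bullet> x)" by simp
    fix h assume "h \<in> S'"
    then obtain g where g: "h = \<beta> \<cdot>\<^sub>v g" "g \<in> S" using S' by auto
    have "d \<bullet> (\<beta> \<cdot>\<^sub>v y g) = \<beta> * (d \<bullet> y g)"
      using cd y[OF g(2)] by (intro scalar_prod_smult_distrib) (auto dest: nonneg_vecs_carrier)
    then have "ereal (d \<bullet> y' h) = ereal \<beta> * ereal (d \<bullet> y g)" using g(1) y' by simp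
    also have "\<dots> \<le> ereal \<beta> * (SUP h\<in>S. ereal (d \<bullet> y h))"
      using \<beta> g(2) by (intro ereal_mult_left_mono SUP_upper) auto
    finally show "ereal (d \<bullet> y' h) \<le> ereal \<beta> * (SUP h\<in>S. ereal (d \<bullet> y h))" .
  qed
  also have "\<dots> = ereal \<beta> * AR_cost c d S x y"
    unfolding AR_cost_def using \<beta> by (simp add: ereal_pos_distrib)
  finally show ?thesis .
qed

text \<open>Needed for two choices of \<open>r\<close>: a row of \<open>B\<close> for feasibility
  and \<open>d\<close> for the cost. The coordinate form serves for nonnegativity.\<close>

lemma scalar_prod_pw_affine_y:
  assumes r: "r \<in> carrier_vec n"
    and y: "\<And>i. i < m \<Longrightarrow> y (\<beta> \<cdot>\<^sub>v unit_vec m i) \<in> carrier_vec n"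
      "y ((\<beta> * \<gamma>) \<cdot>\<^sub>v ones_vec m) \<in> carrier_vec n"
  shows "pw_affine_y m n \<beta> \<gamma> y h \<in> carrier_vec n"
    "r \<bullet> pw_affine_y m n \<beta> \<gamma> y h =
      (\<Sum>i<m. max (h $ i - \<beta> * \<gamma>) 0 / \<beta> * (r \<bullet> y (\<beta> \<cdot>\<^sub>v unit_vec m i)))
      + r \<bullet> y ((\<beta> * \<gamma>) \<cdot>\<^sub>v ones_vec m)"
    "k < n \<Longrightarrow> pw_affine_y m n \<beta> \<gamma> y h $ k =
      (\<Sum>i<m. max (h $ i - \<beta> * \<gamma>) 0 / \<beta> * (y (\<beta> \<cdot>\<^sub>v unit_vec m i) $ k))
      + y ((\<beta> * \<gamma>) \<cdot>\<^sub>v ones_vec m) $ k"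
proof -
  let ?s = "\<lambda>i. max (h $ i - \<beta> * \<gamma>) 0"
  let ?y = "\<lambda>i. y (\<beta> \<cdot>\<^sub>v unit_vec m i)" and ?z = "y ((\<beta> * \<gamma>) \<cdot>\<^sub>v ones_vec m)"
  have carr: "(\<lambda>i. ?s i \<cdot>\<^sub>v ?y i) \<in> {..<m} \<rightarrow> carrier_vec n" using y(1) by auto
  have closed: "finsum_vec TYPE(real) n (\<lambda>i. ?s i \<cdot>\<^sub>v ?y i) {..<m} \<in> carrier_vec n"
    by (rule finsum_vec_closed[OF carr])
  then show carrier: "pw_affine_y m n \<beta> \<gamma> y h \<in> carrier_vec n"
    using y(2) by (simp add: pw_affine_y_def)
  have dims: "dim_vec (?y i) = n" "dim_vec ?z = n" if "i < m" for i using y that by auto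
  have nth: "pw_affine_y m n \<beta> \<gamma> y h $ k = (\<Sum>i<m. ?s i / \<beta> * ?y i $ k) + ?z $ k"
    if k: "k < n" for k
  proof -
    have "finsum_vec TYPE(real) n (\<lambda>i. ?s i \<cdot>\<^sub>v ?y i) {..<m} $ k = (\<Sum>i<m. ?s i * ?y i $ k)"
      using k dims by (simp add: index_finsum_vec[OF _ k carr])
    then show ?thesis
      using k closed y(2) by (simp add: pw_affine_y_def sum_divide_distrib)
  qed
  then show "k < n \<Longrightarrow> pw_affine_y m n \<beta> \<gamma> y h $ k = (\<Sum>i<m. ?s i / \<beta> * ?y i $ k) + ?z $ k" .
  have sp: "r \<bullet> v = (\<Sum>k<n. r $ k * v $ k)" if "v \<in> carrier_vec n" for v
    using that by (auto simp: scalar_prod_def lessThan_atLeast0)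
  have "r \<bullet> pw_affine_y m n \<beta> \<gamma> y h = (\<Sum>k<n. (\<Sum>i<m. ?s i / \<beta> * (r $ k * ?y i $ k)) + r $ k * ?z $ k)"
    unfolding sp[OF carrier]
    by (rule sum.cong) (simp_all add: nth distrib_left sum_distrib_left mult_ac)
  also have "\<dots> = (\<Sum>i<m. \<Sum>k<n. ?s i / \<beta> * (r $ k * ?y i $ k)) + r \<bullet> ?z"
    unfolding sum.distrib sp[OF y(2)] by (subst sum.swap) simp
  also have "(\<Sum>i<m. \<Sum>k<n. ?s i / \<beta> * (r $ k * ?y i $ k)) = (\<Sum>i<m. ?s i / \<beta> * (r \<bullet> ?y i))"
    by (rule sum.cong) (simp_all add: sp y(1) sum_distrib_left)
  finally show "r \<bullet> pw_affine_y m n \<beta> \<gamma> y h = (\<Sum>i<m. ?s i / \<beta> * (r \<bullet> ?y i)) + r \<bullet> ?z" .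
qed

text \<open>In row \<open>j\<close>, let \<open>p\<close> be the first-stage contribution of
  \<open>x\<close>. Averaging the constraints at the scaled unit vectors loses at most
  \<open>p\<close>, as the weights have total at most 1 and \<open>A\<close> is nonnegative; the
  constraint at the scaled all-ones vector loses another \<open>p\<close>. Doubling \<open>x\<close>
  pays for both.\<close>

lemma pw_affine_feasible:
  assumes AB: "A \<in> carrier_mat m n" "0\<^sub>m m n \<le> A" "B \<in> carrier_mat m n"
    and \<beta>: "0 < \<beta>" and D: "dominating_set m \<beta> \<gamma> \<subseteq> carrier_vec m"
    and feas: "AR_feasible n A B (dominating_set m \<beta> \<gamma>) x y"
    and U: "U \<subseteq> carrier_vec m"
    and excess: "\<And>h. h \<in> U \<Longrightarrow> (\<Sum>i<m. max (h $ i - \<beta> * \<gamma>) 0) \<le> \<beta>"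
  shows "AR_feasible n A B U (pw_affine_x x) (pw_affine_y m n \<beta> \<gamma> y)"
proof -
  let ?y = "\<lambda>i. y (\<beta> \<cdot>\<^sub>v unit_vec m i)" and ?z = "y ((\<beta> * \<gamma>) \<cdot>\<^sub>v ones_vec m)"
  have x: "x \<in> nonneg_vecs n"
    and y: "\<And>g. g \<in> dominating_set m \<beta> \<gamma> \<Longrightarrow> y g \<in> nonneg_vecs n"
    and le: "\<And>g j. g \<in> dominating_set m \<beta> \<gamma> \<Longrightarrow> j < m \<Longrightarrow> g $ j \<le> row A j \<bullet> x + row B j \<bullet> y g"
    using feas AR_feasible_iff[OF AB(1,3) D] by auto
  have yi: "?y i \<in> nonneg_vecs n" if "i < m" for i by (rule y[OF unit_vec_in_dominating_set[OF that]])
  have y0: "?z \<in> nonneg_vecs n" by (rule y[OF ones_vec_in_dominating_set])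
  note yc = nonneg_vecs_carrier[OF yi] nonneg_vecs_carrier[OF y0]
  show ?thesis
    unfolding AR_feasible_iff[OF AB(1,3) U]
  proof (intro conjI ballI allI impI)
    show "pw_affine_x x \<in> nonneg_vecs n" using x by (simp add: pw_affine_x_def nonneg_vecs_iff)
    fix h assume h: "h \<in> U"
    let ?s = "\<lambda>i. max (h $ i - \<beta> * \<gamma>) 0 / \<beta>"
    have s: "0 \<le> ?s i" for i using \<beta> by simp
    have s1: "(\<Sum>i<m. ?s i) \<le> 1"
      using excess[OF h] \<beta> by (simp add: sum_divide_distrib[symmetric])
    show "pw_affine_y m n \<beta> \<gamma> y h \<in> nonneg_vecs n"
      unfolding nonneg_vecs_iff
    proof (intro conjI allI impI)
      show "dim_vec (pw_affine_y m n \<beta> \<gamma> y h) = n"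
        using scalar_prod_pw_affine_y(1)[OF nonneg_vecs_carrier[OF x] yc] by simp
      fix k assume k: "k < n"
      have "0 \<le> (\<Sum>i<m. ?s i * ?y i $ k) + ?z $ k"
        using yi y0 s k by (intro add_nonneg_nonneg sum_nonneg mult_nonneg_nonneg) (auto simp: nonneg_vecs_iff)
      then show "0 \<le> pw_affine_y m n \<beta> \<gamma> y h $ k"
        by (subst scalar_prod_pw_affine_y(3)[OF nonneg_vecs_carrier[OF x] yc k])
    qed
    fix j assume j: "j < m"
    have rows: "row A j \<in> carrier_vec n" "row B j \<in> carrier_vec n" using AB j by auto
    define p where "p = row A j \<bullet> x"
    have "row A j \<in> nonneg_vecs n" using AB j by (auto simp: nonneg_vecs_iff less_eq_mat_def)
    then have p: "0 \<le> p" unfolding p_def using x by (rule scalar_prod_nonneg_vecs)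
    \<comment> \<open>The constraint at \<open>\<beta> \<cdot>\<^sub>v unit_vec m i\<close> has
      right-hand side \<open>\<beta>\<close> in row \<open>i\<close> and 0 in all others, so only
      the term \<open>i = j\<close> contributes to the coverage of row \<open>j\<close>.\<close>
    have "(\<Sum>i<m. ?s i * ((if i = j then \<beta> else 0) - p)) \<le> (\<Sum>i<m. ?s i * (row B j \<bullet> ?y i))"
    proof (intro sum_mono mult_left_mono s)
      fix i assume "i \<in> {..<m}"
      then have i: "i < m" by simp
      have "(if i = j then \<beta> else 0) = (\<beta> \<cdot>\<^sub>v unit_vec m i) $ j" using i j by (simp add: unit_vec_def)
      then show "(if i = j then \<beta> else 0) - p \<le> row B j \<bullet> ?y i"
        using le[OF unit_vec_in_dominating_set[OF i] j] by (simp add: p_def)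
    qed
    moreover have "(\<Sum>i<m. ?s i * ((if i = j then \<beta> else 0) - p)) = ?s j * \<beta> - (\<Sum>i<m. ?s i) * p"
    proof -
      have "(\<Sum>i<m. ?s i * ((if i = j then \<beta> else 0) - p)) =
          (\<Sum>i<m. (if i = j then ?s j * \<beta> else 0) - ?s i * p)"
        by (rule sum.cong) (auto simp: right_diff_distrib)
      then show ?thesis using j by (simp only: sum_subtractf sum_distrib_right) simp
    qed
    moreover have "\<beta> * \<gamma> - p \<le> row B j \<bullet> ?z"
      using le[OF ones_vec_in_dominating_set j] j by (simp add: p_def ones_vec_def)
    moreover have "h $ j - \<beta> * \<gamma> \<le> ?s j * \<beta>" using \<beta> by simp
    moreover have "(\<Sum>i<m. ?s i) * p \<le> p" using s1 p s by (intro mult_left_le_one_le sum_nonneg)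
    moreover have "row A j \<bullet> pw_affine_x x = 2 * p"
      unfolding pw_affine_x_def p_def by (rule scalar_prod_smult_distrib[OF rows(1) nonneg_vecs_carrier[OF x]])
    ultimately show "h $ j \<le> row A j \<bullet> pw_affine_x x + row B j \<bullet> pw_affine_y m n \<beta> \<gamma> y h"
      using scalar_prod_pw_affine_y(2)[OF rows(2) yc] by simp
  qed
qed

text \<open>The weighted recourse terms cost at most \<open>M\<close> in total, because the weights
  sum to at most 1 and \<open>M\<close> is nonnegative; the constant term costs at most another
  \<open>M\<close>.\<close>

lemma pw_affine_cost_le:
  assumes c: "c \<in> carrier_vec n" and d: "d \<in> carrier_vec n" and x: "x \<in> carrier_vec n"
    and \<beta>: "0 < \<beta>" and M: "0 \<le> M"
    and y: "\<And>g. g \<in> dominating_set m \<beta> \<gamma> \<Longrightarrow> y g \<in> carrier_vec n \<and> d \<bullet> y g \<le> M"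
    and excess: "(\<Sum>i<m. max (h $ i - \<beta> * \<gamma>) 0) \<le> \<beta>"
  shows "c \<bullet> pw_affine_x x + d \<bullet> pw_affine_y m n \<beta> \<gamma> y h \<le> 2 * (c \<bullet> x + M)"
proof -
  let ?s = "\<lambda>i. max (h $ i - \<beta> * \<gamma>) 0 / \<beta>"
  have yi: "y (\<beta> \<cdot>\<^sub>v unit_vec m i) \<in> carrier_vec n" "d \<bullet> y (\<beta> \<cdot>\<^sub>v unit_vec m i) \<le> M" if "i < m" for i
    using y[OF unit_vec_in_dominating_set[OF that]] by auto
  have y0: "y ((\<beta> * \<gamma>) \<cdot>\<^sub>v ones_vec m) \<in> carrier_vec n" "d \<bullet> y ((\<beta> * \<gamma>) \<cdot>\<^sub>v ones_vec m) \<le> M"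
    using y[OF ones_vec_in_dominating_set] by auto
  have "(\<Sum>i<m. ?s i * (d \<bullet> y (\<beta> \<cdot>\<^sub>v unit_vec m i))) \<le> (\<Sum>i<m. ?s i * M)"
    using yi \<beta> by (intro sum_mono mult_left_mono) auto
  also have "\<dots> = (\<Sum>i<m. max (h $ i - \<beta> * \<gamma>) 0) / \<beta> * M"
    by (simp add: sum_distrib_right sum_divide_distrib)
  also have "\<dots> \<le> 1 * M" using excess \<beta> M by (intro mult_right_mono) auto
  finally have "d \<bullet> pw_affine_y m n \<beta> \<gamma> y h \<le> 2 * M"
    using scalar_prod_pw_affine_y(2)[OF d yi(1) y0(1), of h] y0(2) by simp
  moreover have "c \<bullet> pw_affine_x x = 2 * (c \<bullet> x)"
    unfolding pw_affine_x_def by (rule scalar_prod_smult_distrib[OF c x])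
  ultimately show ?thesis by simp
qed

text \<open>The constant 8 is the factor 2 of \<open>pw_affine_cost_le\<close> times the factor 4 of
  \<open>beta_le\<close>.\<close>

lemma pw_affine_approximation:
  assumes ma: "1 \<le> m" "0 \<le> a" "a \<le> 1"
    and AB: "A \<in> carrier_mat m n" "0\<^sub>m m n \<le> A" "B \<in> carrier_mat m n"
    and cd: "c \<in> nonneg_vecs n" "d \<in> nonneg_vecs n"
    and opt: "AR_optimal n A B c d (dominating_set m (beta m a) (gamma m a)) x y"
  shows "AR_approximation n A B c d (ellipsoid_set m a) (8 * real m powr (2 / 5))
    (pw_affine_x x) (pw_affine_y m n (beta m a) (gamma m a) y)"
proof -
  define b g where "b = beta m a" and "g = gamma m a"
  let ?D = "dominating_set m b g" and ?U = "ellipsoid_set m a"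
  have b: "0 < b" using beta_pos[OF ma] by (simp add: b_def)
  have U: "?U \<subseteq> carrier_vec m" by (auto simp: ellipsoid_set_iff)
  have DU: "?D \<subseteq> (\<lambda>g. b \<cdot>\<^sub>v g) ` ?U" using dominating_set_subset[OF ma] by (simp add: b_def g_def)
  then have D: "?D \<subseteq> carrier_vec m" using U by fastforce
  have feas: "AR_feasible n A B ?D x y"
    and z: "AR_cost c d ?D x y = z_AR n A B c d ?D" "z_AR n A B c d ?D < \<infinity>"
    using opt by (auto simp: AR_optimal_def b_def g_def)
  have x: "x \<in> nonneg_vecs n" and y: "\<And>h. h \<in> ?D \<Longrightarrow> y h \<in> nonneg_vecs n"
    using feas by (auto simp: AR_feasible_def)
  have excess: "(\<Sum>i<m. max (h $ i - b * g) 0) \<le> b" if "h \<in> ?U" for h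
    using sum_excess_le_beta[OF ma that] by (simp add: b_def g_def)
  have "0 \<le> (SUP h\<in>?D. ereal (d \<bullet> y h))"
    by (rule SUP_second_stage_nonneg[of d n "(b * g) \<cdot>\<^sub>v ones_vec m"])
      (use cd y ones_vec_in_dominating_set in auto)
  \<comment> \<open>Nonnegativity excludes minus infinity and the finite optimal value excludes plus
    infinity.\<close>
  then obtain M where M: "(SUP h\<in>?D. ereal (d \<bullet> y h)) = ereal M" "0 \<le> M"
    using z by (cases "SUP h\<in>?D. ereal (d \<bullet> y h)") (auto simp: AR_cost_def)
  have dM: "d \<bullet> y h \<le> M" if "h \<in> ?D" for h
    using SUP_upper[OF that, of "\<lambda>h. ereal (d \<bullet> y h)"] M(1) by simp
  have zD: "z_AR n A B c d ?D = ereal (c \<bullet> x + M)" using z(1) M(1) by (simp add: AR_cost_def)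
  have zU: "ereal ((c \<bullet> x + M) / b) \<le> z_AR n A B c d ?U"
    unfolding z_AR_def
  proof (intro INF_greatest, clarify)
    fix x' y' assume "AR_feasible n A B ?U x' y'"
    then have "ereal (c \<bullet> x + M) \<le> ereal b * AR_cost c d ?U x' y'"
      using z_AR_le_scaled_cost[OF AB(1,3) cd b U DU] zD by simp
    \<comment> \<open>Of the infinite costs, plus infinity is trivial and minus infinity contradicts
      the finite lower bound just obtained.\<close>
    then show "ereal ((c \<bullet> x + M) / b) \<le> AR_cost c d ?U x' y'"
      using b by (cases "AR_cost c d ?U x' y'") (auto simp: field_simps)
  qed
  have cM: "0 \<le> c \<bullet> x + M" using cd x M by (simp add: scalar_prod_nonneg_vecs)
  have "ereal (c \<bullet> pw_affine_x x + d \<bullet> pw_affine_y m n b g y h)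
      \<le> ereal (8 * real m powr (2 / 5)) * z_AR n A B c d ?U" if h: "h \<in> ?U" for h
  proof -
    have "c \<bullet> pw_affine_x x + d \<bullet> pw_affine_y m n b g y h \<le> 2 * (c \<bullet> x + M)"
      using cd x b M(2) y dM excess[OF h]
      by (intro pw_affine_cost_le) (auto intro: nonneg_vecs_carrier)
    also have "\<dots> = 2 * b * ((c \<bullet> x + M) / b)" using b by simp
    also have "\<dots> \<le> 8 * real m powr (2 / 5) * ((c \<bullet> x + M) / b)"
      using beta_le[OF ma] cM b by (intro mult_right_mono) (auto simp: b_def)
    finally have "ereal (c \<bullet> pw_affine_x x + d \<bullet> pw_affine_y m n b g y h)
      \<le> ereal (8 * real m powr (2 / 5)) * ereal ((c \<bullet> x + M) / b)" by simp
    also have "\<dots> \<le> ereal (8 * real m powr (2 / 5)) * z_AR n A B c d ?U"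
      by (intro ereal_mult_left_mono zU) simp
    finally show ?thesis .
  qed
  then show ?thesis
    using pw_affine_feasible[OF AB b D feas U excess]
    by (auto simp: AR_approximation_def b_def g_def)
qed

theorem mainTheorem7:
  shows "(\<forall>m\<ge>1. \<forall>a::real. 0 \<le> a \<longrightarrow> a \<le> 1 \<longrightarrow>
            dominates m (dominating_set m (beta m a) (gamma m a)) (ellipsoid_set m a))
       \<and> (\<exists>C>0. \<forall>m\<ge>1. \<forall>a::real. 0 \<le> a \<longrightarrow> a \<le> 1 \<longrightarrow>
            \<bar>beta m a\<bar> \<le> C * real m powr (2 / 5))
       \<and> (\<exists>C>0. \<forall>m\<ge>1. \<forall>a::real. 0 \<le> a \<longrightarrow> a \<le> 1 \<longrightarrow>
            (\<forall>n A B c d xhat yhat.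
               A \<in> carrier_mat m n \<longrightarrow> 0\<^sub>m m n \<le> A \<longrightarrow> B \<in> carrier_mat m n \<longrightarrow>
               c \<in> nonneg_vecs n \<longrightarrow> d \<in> nonneg_vecs n \<longrightarrow>
               AR_optimal n A B c d (dominating_set m (beta m a) (gamma m a)) xhat yhat \<longrightarrow>
               AR_approximation n A B c d (ellipsoid_set m a) (C * real m powr (2 / 5))
                 (pw_affine_x xhat) (pw_affine_y m n (beta m a) (gamma m a) yhat)))"
proof (intro conjI)
  show "\<exists>C>0. \<forall>m\<ge>1. \<forall>a::real. 0 \<le> a \<longrightarrow> a \<le> 1 \<longrightarrow> \<bar>beta m a\<bar> \<le> C * real m powr (2 / 5)"
  proof (intro exI[of _ 4] conjI allI impI)
    fix m :: nat and a :: real assume "1 \<le> m" "0 \<le> a" "a \<le> 1"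
    then show "\<bar>beta m a\<bar> \<le> 4 * real m powr (2 / 5)"
      using beta_le[of m a] beta_pos[of m a] by simp
  qed simp
qed (use dominates_ellipsoid in blast,
    use pw_affine_approximation in \<open>intro exI[of _ 8] conjI allI impI; simp\<close>)

end
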